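(* Let $\mathcal{C}=(C,d)$ be a finite chain complex of free abelian groups and let $((C,d),H,f,g,\phi,\lambda)$ be a $\lambda$-AT-model for $\mathcal{C}$, where $\lambda$ is a non-zero integer. Then $\mathcal{H}$ (the graded free abelian group generated by $H$) is isomorphic to the free subgroup of $H(\mathcal{C};\mathbf{Z})$. Moreover, $\{g(h): h\in H\}$ is a set of cycles of $\mathcal{C}$ that are not boundaries, are linearly independent over $\mathbf{Z}$, and generate the set $\{\lambda\alpha : \alpha\in F(\mathcal{C};\mathbf{Z})\}$, i.e. for every homology class $\alpha\in F(\mathcal{C};\mathbf{Z})$ the class $\lambda\alpha$ is a $\mathbf{Z}$-linear combination of the classes $[g(h)]$, $h\in H$.
   Context: A finite chain complex $\mathcal{C}$ is a sequence of finitely generated free abelian groups $\mathcal{C}_q$ (zero for $q<0$ and for $q>n$) with differential $d_q:\mathcal{C}_q\to\mathcal{C}_{q-1}$, $d_qd_{q+1}=0$; it is encoded as $(C,d)$ with $C=\{C_q\}$, $C_q$ a finite basis of $\mathcal{C}_q$. For each $q$, $H_q(\mathcal{C};\mathbf{Z})\cong F_q(\mathcal{C};\mathbf{Z})\oplus T_q(\mathcal{C};\mathbf{Z})$ with $F_q$ free (the "free subgroup", i.e. a free complement of the torsion subgroup, of rank the Betti number $\beta_q$) and $T_q$ the torsion subgroup; $F(\mathcal{C};\mathbf{Z})=\{F_q(\mathcal{C};\mathbf{Z})\}$. A $\lambda$-chain contraction ($\lambda\in\mathbf{Z}$, $\lambda\ne0$) of $(\mathcal{C},d)$ to $(\mathcal{C}',d')$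 is a set $(f,g,\phi,\lambda)$ with $f:\mathcal{C}\to\mathcal{C}'$ and $g:\mathcal{C}'\to\mathcal{C}$ chain maps and $\phi=\{\phi_q:\mathcal{C}_q\to\mathcal{C}_{q+1}\}$ homomorphisms such that $fg=\lambda\, id_{\mathcal{C}'}$ and $\lambda\, id_{\mathcal{C}}-gf=\phi d+d\phi$. A $\lambda$-AT-model for $\mathcal{C}=(C,d)$ is a set $((C,d),H,f,g,\phi,\lambda)$ where $H=\{H_q\}$ is a graded set freely generating a chain complex $\mathcal{H}$ with zero differential, and $(f,g,\phi,\lambda)$ is a $\lambda$-chain contraction of $\mathcal{C}$ to $\mathcal{H}$. *)

theory Defs
  imports "HOL-Algebra.Free_Abelian_Groups"
begin

(* Degrees are indexed by int, so that the conventions "zero for q < 0" and "d 0 maps to the zero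
   group" are literal.  The group of q-chains is free_Abelian_group (C q); homomorphisms are only
   relevant on carriers, hence all equations are relativised to them. *)

definition chain_complex ::
    "(int \<Rightarrow> 'a set) \<Rightarrow> (int \<Rightarrow> ('a \<Rightarrow>\<^sub>0 int) \<Rightarrow> ('a \<Rightarrow>\<^sub>0 int)) \<Rightarrow> bool" where
  "chain_complex C d \<longleftrightarrow>
     (\<forall>q. d q \<in> hom (free_Abelian_group (C q)) (free_Abelian_group (C (q - 1)))) \<and>
     (\<forall>q. \<forall>x \<in> carrier (free_Abelian_group (C (q + 1))). d q (d (q + 1) x) = 0)"

definition finite_chain_complex ::
    "(int \<Rightarrow> 'a set) \<Rightarrow> (int \<Rightarrow> ('a \<Rightarrow>\<^sub>0 int) \<Rightarrow> ('a \<Rightarrow>\<^sub>0 int)) \<Rightarrow> bool" where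
  "finite_chain_complex C d \<longleftrightarrow>
     chain_complex C d \<and> (\<forall>q. finite (C q)) \<and>
     (\<exists>n::nat. \<forall>q. q < 0 \<or> q > int n \<longrightarrow> C q = {})"

definition chain_map ::
    "(int \<Rightarrow> 'a set) \<Rightarrow> (int \<Rightarrow> ('a \<Rightarrow>\<^sub>0 int) \<Rightarrow> ('a \<Rightarrow>\<^sub>0 int)) \<Rightarrow>
     (int \<Rightarrow> 'b set) \<Rightarrow> (int \<Rightarrow> ('b \<Rightarrow>\<^sub>0 int) \<Rightarrow> ('b \<Rightarrow>\<^sub>0 int)) \<Rightarrow>
     (int \<Rightarrow> ('a \<Rightarrow>\<^sub>0 int) \<Rightarrow> ('b \<Rightarrow>\<^sub>0 int)) \<Rightarrow> bool" where
  "chain_map C d C' d' f \<longleftrightarrow>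
     (\<forall>q. f q \<in> hom (free_Abelian_group (C q)) (free_Abelian_group (C' q))) \<and>
     (\<forall>q. \<forall>x \<in> carrier (free_Abelian_group (C q)). f (q - 1) (d q x) = d' q (f q x))"

definition chain_contraction ::
    "(int \<Rightarrow> 'a set) \<Rightarrow> (int \<Rightarrow> ('a \<Rightarrow>\<^sub>0 int) \<Rightarrow> ('a \<Rightarrow>\<^sub>0 int)) \<Rightarrow>
     (int \<Rightarrow> 'b set) \<Rightarrow> (int \<Rightarrow> ('b \<Rightarrow>\<^sub>0 int) \<Rightarrow> ('b \<Rightarrow>\<^sub>0 int)) \<Rightarrow>
     (int \<Rightarrow> ('a \<Rightarrow>\<^sub>0 int) \<Rightarrow> ('b \<Rightarrow>\<^sub>0 int)) \<Rightarrow>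
     (int \<Rightarrow> ('b \<Rightarrow>\<^sub>0 int) \<Rightarrow> ('a \<Rightarrow>\<^sub>0 int)) \<Rightarrow>
     (int \<Rightarrow> ('a \<Rightarrow>\<^sub>0 int) \<Rightarrow> ('a \<Rightarrow>\<^sub>0 int)) \<Rightarrow> int \<Rightarrow> bool" where
  "chain_contraction C d C' d' f g \<phi> l \<longleftrightarrow>
     l \<noteq> 0 \<and>
     chain_map C d C' d' f \<and> chain_map C' d' C d g \<and>
     (\<forall>q. \<phi> q \<in> hom (free_Abelian_group (C q)) (free_Abelian_group (C (q + 1)))) \<and>
     (\<forall>q. \<forall>y \<in> carrier (free_Abelian_group (C' q)). f q (g q y) = frag_cmul l y) \<and>
     (\<forall>q. \<forall>x \<in> carrier (free_Abelian_group (C q)).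
        frag_cmul l x - g q (f q x) = \<phi> (q - 1) (d q x) + d (q + 1) (\<phi> q x))"

definition AT_model ::
    "(int \<Rightarrow> 'a set) \<Rightarrow> (int \<Rightarrow> ('a \<Rightarrow>\<^sub>0 int) \<Rightarrow> ('a \<Rightarrow>\<^sub>0 int)) \<Rightarrow> (int \<Rightarrow> 'b set) \<Rightarrow>
     (int \<Rightarrow> ('a \<Rightarrow>\<^sub>0 int) \<Rightarrow> ('b \<Rightarrow>\<^sub>0 int)) \<Rightarrow>
     (int \<Rightarrow> ('b \<Rightarrow>\<^sub>0 int) \<Rightarrow> ('a \<Rightarrow>\<^sub>0 int)) \<Rightarrow>
     (int \<Rightarrow> ('a \<Rightarrow>\<^sub>0 int) \<Rightarrow> ('a \<Rightarrow>\<^sub>0 int)) \<Rightarrow> int \<Rightarrow> bool" where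
  "AT_model C d H f g \<phi> l \<longleftrightarrow>
     finite_chain_complex C d \<and> chain_contraction C d H (\<lambda>q x. 0) f g \<phi> l"

definition cycles ::
    "(int \<Rightarrow> 'a set) \<Rightarrow> (int \<Rightarrow> ('a \<Rightarrow>\<^sub>0 int) \<Rightarrow> ('a \<Rightarrow>\<^sub>0 int)) \<Rightarrow> int \<Rightarrow> ('a \<Rightarrow>\<^sub>0 int) set" where
  "cycles C d q = kernel (free_Abelian_group (C q)) (free_Abelian_group (C (q - 1))) (d q)"

definition boundaries ::
    "(int \<Rightarrow> 'a set) \<Rightarrow> (int \<Rightarrow> ('a \<Rightarrow>\<^sub>0 int) \<Rightarrow> ('a \<Rightarrow>\<^sub>0 int)) \<Rightarrow> int \<Rightarrow> ('a \<Rightarrow>\<^sub>0 int) set" where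
  "boundaries C d q = d (q + 1) ` carrier (free_Abelian_group (C (q + 1)))"

definition cycle_group ::
    "(int \<Rightarrow> 'a set) \<Rightarrow> (int \<Rightarrow> ('a \<Rightarrow>\<^sub>0 int) \<Rightarrow> ('a \<Rightarrow>\<^sub>0 int)) \<Rightarrow> int \<Rightarrow> ('a \<Rightarrow>\<^sub>0 int) monoid" where
  "cycle_group C d q = subgroup_generated (free_Abelian_group (C q)) (cycles C d q)"

definition homology ::
    "(int \<Rightarrow> 'a set) \<Rightarrow> (int \<Rightarrow> ('a \<Rightarrow>\<^sub>0 int) \<Rightarrow> ('a \<Rightarrow>\<^sub>0 int)) \<Rightarrow> int \<Rightarrow>
     ('a \<Rightarrow>\<^sub>0 int) set monoid" where
  "homology C d q = cycle_group C d q Mod boundaries C d q"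

definition homology_class ::
    "(int \<Rightarrow> 'a set) \<Rightarrow> (int \<Rightarrow> ('a \<Rightarrow>\<^sub>0 int) \<Rightarrow> ('a \<Rightarrow>\<^sub>0 int)) \<Rightarrow> int \<Rightarrow>
     ('a \<Rightarrow>\<^sub>0 int) \<Rightarrow> ('a \<Rightarrow>\<^sub>0 int) set" where
  "homology_class C d q z = boundaries C d q #>\<^bsub>cycle_group C d q\<^esub> z"

definition torsion_subgroup :: "('g, 'm) monoid_scheme \<Rightarrow> 'g set" where
  "torsion_subgroup G = {x \<in> carrier G. \<exists>n::nat. n > 0 \<and> x [^]\<^bsub>G\<^esub> n = \<one>\<^bsub>G\<^esub>}"

(* Restricting the generating set to the element type of G loses nothing, because a basis of a
   free abelian group consists of elements of the group. *)
definition is_free_Abelian :: "('g, 'm) monoid_scheme \<Rightarrow> bool" where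
  "is_free_Abelian G \<longleftrightarrow> (\<exists>B :: 'g set. G \<cong> free_Abelian_group B)"

(* A free complement of the torsion subgroup (internal direct product).  It is unique only up to
   isomorphism, so "the" free subgroup of homology is any choice of such complements. *)
definition free_complement :: "('g, 'm) monoid_scheme \<Rightarrow> 'g set \<Rightarrow> bool" where
  "free_complement G F \<longleftrightarrow>
     subgroup F G \<and> is_free_Abelian (subgroup_generated G F) \<and>
     torsion_subgroup G \<inter> F = {\<one>\<^bsub>G\<^esub>} \<and> torsion_subgroup G <#>\<^bsub>G\<^esub> F = carrier G"

definition free_homology ::
    "(int \<Rightarrow> 'a set) \<Rightarrow> (int \<Rightarrow> ('a \<Rightarrow>\<^sub>0 int) \<Rightarrow> ('a \<Rightarrow>\<^sub>0 int)) \<Rightarrow>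
     (int \<Rightarrow> ('a \<Rightarrow>\<^sub>0 int) set set) \<Rightarrow> bool" where
  "free_homology C d F \<longleftrightarrow> (\<forall>q. free_complement (homology C d q) (F q))"

(* Linear independence over the integers of the family (v h | h \<in> S) in the multiplicatively
   written abelian group G; an element of 'h \<Rightarrow>\<^sub>0 int is a finitely supported coefficient family. *)
definition Z_independent :: "('g, 'm) monoid_scheme \<Rightarrow> 'h set \<Rightarrow> ('h \<Rightarrow> 'g) \<Rightarrow> bool" where
  "Z_independent G S v \<longleftrightarrow>
     (\<forall>a :: 'h \<Rightarrow>\<^sub>0 int. Poly_Mapping.keys a \<subseteq> S \<and>
        finprod G (\<lambda>h. v h [^]\<^bsub>G\<^esub> Poly_Mapping.lookup a h) (Poly_Mapping.keys a) = \<one>\<^bsub>G\<^esub>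
        \<longrightarrow> a = 0)"

end

(* The map f induces p : H(C) -> Z[H] and g induces k : Z[H] -> H(C), with p k = l and k p = l.
   As Z[H] is torsion-free, the kernel of p is the torsion subgroup, so p embeds every free
   complement F onto the image of p.  That image lies between l Z[H] and Z[H], hence is free on as
   many generators as Z[H] itself; lifting such generators through p also yields a complement.
   Independence of the classes [g(h)] follows by applying p, and l \<alpha> = k (p \<alpha>) is a combination
   of them. *)

theory Submission
  imports Defs
begin

section \<open>Subgroups of a free abelian group of finite rank that contain all multiples by a
  fixed nonzero integer\<close>

text \<open>A triangular basis: the new basis vector \<open>w\<close> at \<open>s\<close> is an element of \<open>I\<close> whose
  \<open>s\<close>-coordinate generates the ideal of all \<open>s\<close>-coordinates of \<open>I\<close>.\<close>

lemma lattice_basis_exists: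
  fixes I :: "('a \<Rightarrow>\<^sub>0 int) set" and l :: int
  assumes "finite S" "l \<noteq> 0"
    and "\<And>x. x \<in> I \<Longrightarrow> Poly_Mapping.keys x \<subseteq> S" "0 \<in> I"
    and "\<And>x y. x \<in> I \<Longrightarrow> y \<in> I \<Longrightarrow> x - y \<in> I"
    and "\<And>x. Poly_Mapping.keys x \<subseteq> S \<Longrightarrow> frag_cmul l x \<in> I"
  shows "\<exists>b. frag_extend b ` {x. Poly_Mapping.keys x \<subseteq> S} = I \<and>
             (\<forall>x. Poly_Mapping.keys x \<subseteq> S \<longrightarrow> frag_extend b x = 0 \<longrightarrow> x = 0)"
  using assms
proof (induction S arbitrary: I rule: finite_induct)
  case empty
  then have "I = {0}" by auto
  then show ?case by auto
next
  case (insert s S)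
  note keys_I = insert.prems(2) and zero_I = insert.prems(3) and diff_I = insert.prems(4)
    and mult_I = insert.prems(5)
  have cmul_I: "frag_cmul c x \<in> I" if "x \<in> I" for c x
    using frag_closure_minus_cmul [of "\<lambda>x. x \<in> I"] zero_I diff_I that by auto
  have add_I: "x + y \<in> I" if "x \<in> I" "y \<in> I" for x y
    using diff_I [OF that(1) diff_I [OF zero_I that(2)]] by simp
  \<comment> \<open>The members of \<open>I\<close> with zero \<open>s\<close>-coordinate form a
    lattice over \<open>S\<close>, to which the induction hypothesis applies.\<close>
  define I' where "I' = I \<inter> {x. Poly_Mapping.keys x \<subseteq> S}"
  have "\<exists>b. frag_extend b ` {x. Poly_Mapping.keys x \<subseteq> S} = I' \<and>
            (\<forall>x. Poly_Mapping.keys x \<subseteq> S \<longrightarrow> frag_extend b x = 0 \<longrightarrow> x = 0)"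
  proof (rule insert.IH)
    show "x - y \<in> I'" if "x \<in> I'" "y \<in> I'" for x y
      using that diff_I keys_diff [of x y] unfolding I'_def by blast
    show "frag_cmul l x \<in> I'" if "Poly_Mapping.keys x \<subseteq> S" for x
      using that mult_I [of x] keys_cmul [of l x] unfolding I'_def by blast
  qed (use \<open>l \<noteq> 0\<close> zero_I in \<open>auto simp: I'_def\<close>)
  then obtain b where b_image: "frag_extend b ` {x. Poly_Mapping.keys x \<subseteq> S} = I'"
    and b_zero: "\<And>x. Poly_Mapping.keys x \<subseteq> S \<Longrightarrow> frag_extend b x = 0 \<Longrightarrow> x = 0"
    by blast
  \<comment> \<open>The least \<open>n\<close> satisfying \<open>P\<close> will be the positive
    generator \<open>a\<close> of the ideal of \<open>s\<close>-coordinates of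
    \<open>I\<close>.\<close>
  define P where "P n \<longleftrightarrow> n > 0 \<and> (\<exists>x\<in>I. Poly_Mapping.lookup x s = int n)" for n
  \<comment> \<open>This ideal is nonzero, since \<open>I\<close> contains \<open>l\<close> times
    the generator at \<open>s\<close>; the factor \<open>sgn l\<close> makes the coordinate
    positive.\<close>
  have "P (nat \<bar>l\<bar>)"
  proof -
    have "frag_cmul (sgn l) (frag_cmul l (frag_of s)) \<in> I"
      by (intro cmul_I mult_I) simp
    then have "\<exists>x\<in>I. Poly_Mapping.lookup x s = \<bar>l\<bar>"
      by (rule bexI [rotated]) (simp add: abs_sgn mult.commute)
    then show ?thesis
      using \<open>l \<noteq> 0\<close> unfolding P_def by simp
  qed
  then have P_Least: "P (LEAST n. P n)"
    by (rule LeastI)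
  define a where "a = int (LEAST n. P n)"
  obtain w where w: "w \<in> I" "Poly_Mapping.lookup w s = a" and "a > 0"
    using P_Least unfolding P_def a_def by auto
  \<comment> \<open>Division with remainder: \<open>r\<close> is again an
    \<open>s\<close>-coordinate of a member of \<open>I\<close>, and minimality of \<open>a\<close>
    forces it to vanish.\<close>
  have a_dvd: "a dvd Poly_Mapping.lookup x s" if "x \<in> I" for x
  proof -
    define r where "r = Poly_Mapping.lookup x s mod a"
    have "x - frag_cmul (Poly_Mapping.lookup x s div a) w \<in> I"
      using that w by (intro diff_I cmul_I)
    moreover have "Poly_Mapping.lookup (x - frag_cmul (Poly_Mapping.lookup x s div a) w) s = r"
      by (simp add: r_def w lookup_minus minus_div_mult_eq_mod)
    moreover have "0 \<le> r" "r < a"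
      using \<open>a > 0\<close> by (simp_all add: r_def)
    ultimately have "r = 0"
      using not_less_Least [of "nat r" P] unfolding P_def a_def by (cases "r = 0") auto
    then show ?thesis
      by (simp add: r_def dvd_eq_mod_eq_0)
  qed
  define b' where "b' = b(s := w)"
  have b'_S: "frag_extend b' x = frag_extend b x" if "Poly_Mapping.keys x \<subseteq> S" for x
    by (rule frag_extend_eq) (use that \<open>s \<notin> S\<close> in \<open>auto simp: b'_def\<close>)
  have split: "\<exists>x'. Poly_Mapping.keys x' \<subseteq> S \<and>
       x = x' + frag_cmul (Poly_Mapping.lookup x s) (frag_of s)"
    if "Poly_Mapping.keys x \<subseteq> insert s S" for x
    using that
    by (intro exI [of _ "x - frag_cmul (Poly_Mapping.lookup x s) (frag_of s)"])
      (auto simp: in_keys_iff lookup_minus split: if_splits)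
  have b'_add: "frag_extend b' (x + frag_cmul c (frag_of s)) = frag_extend b x + frag_cmul c w"
    if "Poly_Mapping.keys x \<subseteq> S" for x c
    using that by (simp add: frag_extend_add frag_extend_cmul b'_S) (simp add: b'_def)
  have b_I': "frag_extend b x \<in> I'" if "Poly_Mapping.keys x \<subseteq> S" for x
    using b_image that by blast
  have lookup_I': "Poly_Mapping.lookup x s = 0" if "x \<in> I'" for x
    using that \<open>s \<notin> S\<close> by (auto simp: I'_def in_keys_iff)
  show ?case
  proof (intro exI [of _ b'] conjI allI impI subset_antisym subsetI)
    fix y
    assume "y \<in> frag_extend b' ` {x. Poly_Mapping.keys x \<subseteq> insert s S}"
    then obtain x where "Poly_Mapping.keys x \<subseteq> insert s S" "y = frag_extend b' x"
      by blast
    then obtain x' c where "Poly_Mapping.keys x' \<subseteq> S" "y = frag_extend b x' + frag_cmul c w"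
      using split b'_add by metis
    then show "y \<in> I"
      using b_I' [of x'] w by (auto simp: I'_def intro: add_I cmul_I)
  next
    fix y
    assume "y \<in> I"
    then obtain c where c: "Poly_Mapping.lookup y s = c * a"
      using a_dvd by (metis dvdE mult.commute)
    \<comment> \<open>Subtracting \<open>c\<close> times \<open>w\<close> clears the
      \<open>s\<close>-coordinate, which leaves an element in the span of \<open>b\<close>.\<close>
    have "y - frag_cmul c w \<in> I"
      using \<open>y \<in> I\<close> w by (intro diff_I cmul_I)
    moreover have "Poly_Mapping.lookup (y - frag_cmul c w) s = 0"
      by (simp add: lookup_minus c w)
    ultimately have "y - frag_cmul c w \<in> I'"
      using keys_I [of "y - frag_cmul c w"] by (auto simp: I'_def in_keys_iff)
    then obtain x where x: "Poly_Mapping.keys x \<subseteq> S" "frag_extend b x = y - frag_cmul c w"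
      unfolding b_image [symmetric] by (elim imageE) auto
    then have "y = frag_extend b' (x + frag_cmul c (frag_of s))"
      by (simp add: b'_add)
    moreover have "Poly_Mapping.keys (x + frag_cmul c (frag_of s)) \<subseteq> insert s S"
      using keys_add [of x "frag_cmul c (frag_of s)"] keys_cmul [of c "frag_of s"] x by auto
    ultimately show "y \<in> frag_extend b' ` {x. Poly_Mapping.keys x \<subseteq> insert s S}"
      by blast
  next
    fix x
    assume "Poly_Mapping.keys x \<subseteq> insert s S" and zero: "frag_extend b' x = 0"
    then obtain x' where x': "Poly_Mapping.keys x' \<subseteq> S"
      "x = x' + frag_cmul (Poly_Mapping.lookup x s) (frag_of s)"
      using split by blast
    then have eq: "frag_extend b x' + frag_cmul (Poly_Mapping.lookup x s) w = 0"
      using zero b'_add by metis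
    \<comment> \<open>Members of \<open>I'\<close> vanish at \<open>s\<close>, so the
      \<open>s\<close>-coordinate of the relation sees only the multiple of
      \<open>w\<close>.\<close>
    have "Poly_Mapping.lookup (frag_extend b x' + frag_cmul (Poly_Mapping.lookup x s) w) s
        = Poly_Mapping.lookup x s * a"
      using lookup_I' [OF b_I' [OF x'(1)]] by (simp add: lookup_add w)
    then have "Poly_Mapping.lookup x s = 0"
      using \<open>a > 0\<close> by (simp add: eq)
    then show "x = 0"
      using x' eq b_zero by (metis add.right_neutral frag_cmul_zero)
  qed
qed

lemma frag_extend_hom:
  assumes "\<And>x. x \<in> S \<Longrightarrow> Poly_Mapping.keys (b x) \<subseteq> T"
  shows "frag_extend b \<in> hom (free_Abelian_group S) (free_Abelian_group T)"
proof (rule homI)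
  fix x
  assume "x \<in> carrier (free_Abelian_group S)"
  then show "frag_extend b x \<in> carrier (free_Abelian_group T)"
    using keys_frag_extend [of b x] assms by fastforce
qed (simp add: frag_extend_add)

text \<open>The triangular basis of \<open>I\<close> is indexed by \<open>S\<close> itself, so its
  linear extension is the required isomorphism. Closure under multiplication by \<open>l\<close>
  keeps the rank from dropping.\<close>

lemma iso_free_Abelian_group_sublattice:
  assumes "finite S" "l \<noteq> 0" and I: "subgroup I (free_Abelian_group S)"
    and mult: "\<And>x. x \<in> carrier (free_Abelian_group S) \<Longrightarrow> frag_cmul l x \<in> I"
  shows "\<exists>u. u \<in> iso (free_Abelian_group S) (subgroup_generated (free_Abelian_group S) I)"
proof -
  let ?A = "free_Abelian_group S"
  have keys: "Poly_Mapping.keys x \<subseteq> S" if "x \<in> I" for x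
    using subgroup.mem_carrier [OF I that] by simp
  have "\<exists>b. frag_extend b ` {x. Poly_Mapping.keys x \<subseteq> S} = I \<and>
            (\<forall>x. Poly_Mapping.keys x \<subseteq> S \<longrightarrow> frag_extend b x = 0 \<longrightarrow> x = 0)"
  proof (rule lattice_basis_exists [OF \<open>finite S\<close> \<open>l \<noteq> 0\<close> keys])
    show "0 \<in> I"
      using subgroup.one_closed [OF I] by simp
    show "x - y \<in> I" if "x \<in> I" "y \<in> I" for x y
      using subgroup.m_closed [OF I that(1) subgroup.m_inv_closed [OF I that(2)]] keys [OF that(2)]
      by simp
  qed (use mult in auto)
  then obtain b where image: "frag_extend b ` carrier ?A = I"
    and zero: "\<And>x. x \<in> carrier ?A \<Longrightarrow> frag_extend b x = 0 \<Longrightarrow> x = 0"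
    by (auto simp: free_Abelian_group_def)
  have hom: "frag_extend b \<in> hom ?A ?A"
  proof (rule frag_extend_hom)
    show "Poly_Mapping.keys (b x) \<subseteq> S" if "x \<in> S" for x
      using imageI [of "frag_of x" "carrier ?A" "frag_extend b"] that keys unfolding image by simp
  qed
  then have "inj_on (frag_extend b) (carrier ?A)"
    using zero by (auto simp: inj_on_one_iff')
  then show ?thesis
    using hom iso_onto_image [of ?A ?A "frag_extend b"] unfolding image by auto
qed

section \<open>Linear independence detected by a homomorphism to a free abelian group\<close>

lemma hom_finprod_free_Abelian_group:
  assumes "comm_group G" "p \<in> hom G (free_Abelian_group S)" "v \<in> B \<rightarrow> carrier G"
  shows "p (finprod G v B) = (\<Sum>h\<in>B. p (v h))"
proof -
  interpret G: comm_group G by fact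
  interpret p: group_hom G "free_Abelian_group S" p
    using assms(2) by (simp add: group_hom_def group_hom_axioms_def)
  show ?thesis
    using \<open>v \<in> B \<rightarrow> carrier G\<close>
    using p.hom_one by (induction B rule: infinite_finite_induct) (auto simp: Pi_iff)
qed

text \<open>Applying \<open>p\<close> to a vanishing combination with coefficients \<open>a\<close>
  gives \<open>frag_cmul l a = 0\<close>, and a free abelian group has no torsion. This serves both
  for chains and for homology classes.\<close>

lemma Z_independentI:
  assumes "comm_group G" and hom: "p \<in> hom G (free_Abelian_group S)" and "l \<noteq> 0"
    and v: "\<And>h. h \<in> S \<Longrightarrow> v h \<in> carrier G" "\<And>h. h \<in> S \<Longrightarrow> p (v h) = frag_cmul l (frag_of h)"
  shows "Z_independent G S v"
  unfolding Z_independent_def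
proof (intro allI impI, elim conjE)
  fix a :: "_ \<Rightarrow>\<^sub>0 int"
  assume a: "Poly_Mapping.keys a \<subseteq> S"
    and one: "finprod G (\<lambda>h. v h [^]\<^bsub>G\<^esub> Poly_Mapping.lookup a h) (Poly_Mapping.keys a) = \<one>\<^bsub>G\<^esub>"
  interpret G: comm_group G by fact
  interpret p: group_hom G "free_Abelian_group S" p
    using hom by (simp add: group_hom_def group_hom_axioms_def)
  have p_pow: "p (v h [^]\<^bsub>G\<^esub> c) = frag_cmul (l * c) (frag_of h)" if "h \<in> S" for h and c :: int
    using that v p.hom_closed [OF v(1)] by (simp add: p.hom_int_pow mult.commute)
  have "0 = p (finprod G (\<lambda>h. v h [^]\<^bsub>G\<^esub> Poly_Mapping.lookup a h) (Poly_Mapping.keys a))"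
    using p.hom_one by (simp add: one)
  also have "\<dots> = (\<Sum>h\<in>Poly_Mapping.keys a. p (v h [^]\<^bsub>G\<^esub> Poly_Mapping.lookup a h))"
    by (intro hom_finprod_free_Abelian_group [OF \<open>comm_group G\<close> hom] Pi_I
        G.int_pow_closed v(1) subsetD [OF a])
  also have "\<dots> = (\<Sum>h\<in>Poly_Mapping.keys a. frag_cmul l (frag_cmul (Poly_Mapping.lookup a h) (frag_of h)))"
    using a p_pow by (intro sum.cong) auto
  also have "\<dots> = frag_cmul l (frag_extend frag_of a)"
    by (simp add: frag_extend_def frag_cmul_sum)
  also have "\<dots> = frag_cmul l a"
    by (simp flip: frag_expansion)
  finally show "a = 0"
    using \<open>l \<noteq> 0\<close> by simp
qed

section \<open>Abelian groups that agree with a free abelian group up to multiplication by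
  \<open>l\<close>\<close>

text \<open>\<open>G\<close> abstracts a homology group, with \<open>p\<close> and \<open>k\<close>
  the maps induced by \<open>f\<close> and \<open>g\<close>. All facts about torsion and complements
  follow from these axioms without reference to chains.\<close>

locale free_quasi_inverse = comm_group G
  for G (structure) +
  fixes S :: "'h set" and p :: "'a \<Rightarrow> 'h \<Rightarrow>\<^sub>0 int" and k :: "('h \<Rightarrow>\<^sub>0 int) \<Rightarrow> 'a" and l :: int
  assumes p_hom: "p \<in> hom G (free_Abelian_group S)"
    and k_hom: "k \<in> hom (free_Abelian_group S) G"
    and p_k: "y \<in> carrier (free_Abelian_group S) \<Longrightarrow> p (k y) = frag_cmul l y"
    and k_p: "x \<in> carrier G \<Longrightarrow> k (p x) = x [^] l"
    and l_nonzero: "l \<noteq> 0"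
begin

abbreviation A where "A \<equiv> free_Abelian_group S"

sublocale p: group_hom G A p
  using p_hom by (simp add: group_hom_def group_hom_axioms_def)

sublocale k: group_hom A G k
  using k_hom by (simp add: group_hom_def group_hom_axioms_def)

text \<open>Torsion dies in the torsion-free group \<open>A\<close>; conversely
  \<open>p x = 0\<close> gives \<open>x [^] l = k (p x) = \<one>\<close>.\<close>

lemma torsion_subgroup_eq_kernel: "torsion_subgroup G = kernel G A p"
proof (intro equalityI subsetI)
  fix x
  assume "x \<in> torsion_subgroup G"
  then obtain n :: nat where n: "x \<in> carrier G" "n > 0" "x [^] n = \<one>"
    by (auto simp: torsion_subgroup_def)
  have "frag_cmul (int n) (p x) = p (x [^] n)"
    using n(1) by (simp add: p.hom_nat_pow)
  then show "x \<in> kernel G A p"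
    using n p.hom_one by (simp add: kernel_def)
next
  fix x
  assume "x \<in> kernel G A p"
  then have x: "x \<in> carrier G" "p x = 0"
    by (auto simp: kernel_def)
  then have l: "x [^] l = \<one>"
    using k_p [of x] k.hom_one by simp
  \<comment> \<open>Torsion is defined by positive natural exponents, whereas \<open>l\<close> may
    be negative.\<close>
  have "x [^] nat \<bar>l\<bar> = x [^] \<bar>l\<bar>"
    by (metis abs_ge_zero int_nat_eq int_pow_int)
  also have "\<dots> = \<one>"
    using x l by (auto simp: abs_if int_pow_neg)
  finally show "x \<in> torsion_subgroup G"
    unfolding torsion_subgroup_def using x l_nonzero by (auto intro!: exI [of _ "nat \<bar>l\<bar>"])
qed

lemma image_subgroup: "subgroup (p ` carrier G) A"
  by (rule p.img_is_subgroup)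

text \<open>The image of \<open>p\<close> contains \<open>l\<close> times every \<open>x\<close> in
  \<open>A\<close>, namely as \<open>p (k x)\<close>, so the sublattice result applies.\<close>

lemma iso_onto_range:
  assumes "finite S"
  shows "\<exists>u. u \<in> iso A (subgroup_generated A (p ` carrier G))"
proof (rule iso_free_Abelian_group_sublattice [OF assms l_nonzero image_subgroup])
  fix x
  assume "x \<in> carrier A"
  then show "frag_cmul l x \<in> p ` carrier G"
    using p_k [of x] k.hom_closed by (metis imageI)
qed

text \<open>Trivial intersection with the kernel makes \<open>p\<close> injective on
  \<open>F\<close>. Since every element of \<open>G\<close> is a kernel element times a member of
  \<open>F\<close>, restricting \<open>p\<close> to \<open>F\<close> does not shrink its
  image.\<close>

lemma free_complement_iso:
  assumes "finite S" and F: "free_complement G F"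
  shows "A \<cong> subgroup_generated G F"
proof -
  have sub: "subgroup F G" and triv: "kernel G A p \<inter> F = {\<one>}"
    and gen: "kernel G A p <#> F = carrier G"
    using F by (auto simp: free_complement_def torsion_subgroup_eq_kernel)
  have carrier_F: "carrier (subgroup_generated G F) = F"
    by (rule subgroup.carrier_subgroup_generated_subgroup [OF sub])
  have hom: "p \<in> hom (subgroup_generated G F) A"
    by (rule hom_from_subgroup_generated [OF p_hom])
  have "x = \<one>" if "x \<in> F" "p x = 0" for x
    using that triv subgroup.mem_carrier [OF sub] by (auto simp: kernel_def)
  then have "inj_on p (carrier (subgroup_generated G F))"
    using inj_on_one_iff' [OF hom] by (simp add: carrier_F)
  then have iso_F: "p \<in> iso (subgroup_generated G F) (subgroup_generated A (p ` F))"
    using hom Generated_Groups.iso_onto_image [of "subgroup_generated G F" A p] by (simp add: carrier_F)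
  have "p ` F = p ` carrier G"
  proof (intro equalityI subsetI)
    fix y
    assume "y \<in> p ` carrier G"
    then obtain t x where "t \<in> kernel G A p" "x \<in> F" "y = p (t \<otimes> x)"
      using gen unfolding set_mult_def by (smt (verit, best) UN_E image_iff singletonD)
    then have "y = p x"
      using subgroup.mem_carrier [OF sub] by (simp add: kernel_def)
    then show "y \<in> p ` F"
      using \<open>x \<in> F\<close> by blast
  qed (use subgroup.mem_carrier [OF sub] in auto)
  then have "subgroup_generated G F \<cong> subgroup_generated A (p ` carrier G)"
    using iso_F by (auto simp: is_iso_def)
  moreover have "A \<cong> subgroup_generated A (p ` carrier G)"
    using iso_onto_range [OF \<open>finite S\<close>] by (auto simp: is_iso_def)
  ultimately show ?thesis
    by (meson group.iso_sym group_subgroup_generated iso_trans)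
qed

text \<open>The image of \<open>p\<close> is free, so \<open>p\<close> splits over it; the range of
  the splitting is the complement.\<close>

lemma free_complement_exists:
  assumes "finite S"
  shows "\<exists>F. free_complement G F"
proof -
  obtain u where u: "u \<in> iso A (subgroup_generated A (p ` carrier G))"
    using iso_onto_range [OF assms] by blast
  have u_hom: "u \<in> hom A A" and u_image: "u ` carrier A = p ` carrier G"
    and u_inj: "inj_on u (carrier A)"
    using u subgroup.carrier_subgroup_generated_subgroup [OF image_subgroup]
    by (auto simp: iso_def bij_betw_def hom_into_subgroup_eq_gen)
  \<comment> \<open>The elements \<open>u (frag_of s)\<close> form a basis of the image of
    \<open>p\<close>; \<open>z\<close> chooses preimages of them and \<open>j\<close> extends this
    choice to a homomorphism.\<close>
  have "\<exists>x \<in> carrier G. p x = u (frag_of s)" if "s \<in> S" for s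
    using u_image that by (metis frag_of_in_free_Abelian_group imageE imageI)
  then obtain z where z: "z s \<in> carrier G" "p (z s) = u (frag_of s)" if "s \<in> S" for s
    by metis
  obtain j where j: "j \<in> hom A G" "\<And>s. s \<in> S \<Longrightarrow> j (frag_of s) = z s"
    using free_Abelian_group_universal [of z S] z by (metis image_subsetI)
  interpret j: group_hom A G j
    using j by (simp add: group_hom_def group_hom_axioms_def)
  interpret u: group_hom A A u
    using u_hom by (simp add: group_hom_def group_hom_axioms_def)
  \<comment> \<open>Both sides are homomorphisms in \<open>x\<close> that agree on generators.
    Injectivity of \<open>u\<close> then passes to \<open>j\<close>.\<close>
  have p_j: "p (j x) = u x" if "x \<in> carrier A" for x
  proof -
    have "Poly_Mapping.keys x \<subseteq> S"
      using that by simp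
    then show ?thesis
    proof (induction rule: free_Abelian_group_induct [consumes 1, case_names zero diff frag_of])
      case (diff x y)
      have minus: "f (x - y) = f x - f y" if "f \<in> hom A A" for f
        using hom_frag_diff [OF that] diff by simp
      show ?case
        using minus [OF u_hom] minus [OF Group.hom_compose [OF j(1) p_hom]] diff by simp
    qed (use j z u.hom_one j.hom_one p.hom_one in auto)
  qed
  define F where "F = j ` carrier A"
  have F_sub: "subgroup F G"
    unfolding F_def by (rule j.img_is_subgroup)
  have j_inj: "inj_on j (carrier A)"
    using u_inj p_j by (metis (no_types, lifting) inj_on_def)
  then have "j \<in> iso A (subgroup_generated G F)"
    unfolding F_def using Generated_Groups.iso_onto_image [of A G j] j(1) by simp
  then have "A \<cong> subgroup_generated G F"
    by (auto simp: is_iso_def)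
  then have iso_F: "subgroup_generated G F \<cong> A"
    by (rule group.iso_sym [OF group_free_Abelian_group])
  \<comment> \<open>\<open>is_free_Abelian\<close> asks for generators of the element type of the
    group, so \<open>S\<close> is replaced by its equipollent copy inside \<open>G\<close>.\<close>
  have "inj_on (\<lambda>s. j (frag_of s)) S"
    using j_inj by (auto intro!: inj_onI simp: frag_of_eq dest!: inj_onD)
  then have "S \<approx> (\<lambda>s. j (frag_of s)) ` S"
    by (meson eqpoll_sym inj_on_image_eqpoll_self)
  then have "is_free_Abelian (subgroup_generated G F)"
    unfolding is_free_Abelian_def using iso_F isomorphic_free_Abelian_groups iso_trans by blast
  moreover have "kernel G A p \<inter> F = {\<one>}"
  proof (intro equalityI subsetI)
    fix x
    assume "x \<in> kernel G A p \<inter> F"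
    then obtain y where y: "y \<in> carrier A" "x = j y" "u y = 0"
      using p_j by (auto simp: kernel_def F_def)
    then have "y = 0"
      using u_inj u.hom_one by (metis inj_onD one_free_Abelian_group u.one_closed)
    then show "x \<in> {\<one>}"
      using y j.hom_one by simp
  qed (use subgroup.one_closed [OF F_sub] p.hom_one in \<open>auto simp: kernel_def\<close>)
  moreover have "kernel G A p <#> F = carrier G"
  proof (intro equalityI subsetI)
    fix x
    assume x: "x \<in> carrier G"
    then obtain y where y: "y \<in> carrier A" "p x = u y"
      using u_image by (metis imageE imageI)
    have closed: "j y \<in> carrier G"
      by (rule j.hom_closed [OF y(1)])
    \<comment> \<open>The torsion component of \<open>x\<close> is its quotient by
      \<open>j y\<close>, which has the same image under \<open>p\<close>.\<close>
    have "p (x \<otimes> inv (j y)) = p x \<otimes>\<^bsub>A\<^esub> inv\<^bsub>A\<^esub> (p (j y))"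
      using x closed by simp
    also have "\<dots> = \<one>\<^bsub>A\<^esub>"
      using p.hom_closed [OF x] by (simp only: p_j [OF y(1)] y(2) p.H.r_inv)
    finally have "x \<otimes> inv (j y) \<in> kernel G A p"
      using x closed by (simp add: kernel_def)
    moreover have "x = (x \<otimes> inv (j y)) \<otimes> j y"
      using x closed by (simp add: m_assoc)
    ultimately show "x \<in> kernel G A p <#> F"
      unfolding set_mult_def F_def using y by blast
  qed (use subgroup.mem_carrier [OF F_sub] in \<open>auto simp: set_mult_def kernel_def\<close>)
  ultimately show ?thesis
    unfolding free_complement_def torsion_subgroup_eq_kernel using F_sub by blast
qed

text \<open>The power is \<open>k (p x)\<close>, and \<open>p x\<close> is an integer combination of
  the generators \<open>frag_of h\<close>.\<close>

lemma pow_in_generate: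
  assumes "x \<in> carrier G"
  shows "x [^] l \<in> generate G ((\<lambda>h. k (frag_of h)) ` S)" (is "_ \<in> generate G ?B")
proof -
  have B: "?B \<subseteq> carrier G"
    using k.hom_closed by auto
  have "k y \<in> generate G ?B" if "Poly_Mapping.keys y \<subseteq> S" for y
    using that
  proof (induction rule: free_Abelian_group_induct [consumes 1, case_names zero diff frag_of])
    case zero
    then show ?case
      using k.hom_one generate.one [of G] by simp
  next
    case (diff x y)
    have "k (x - y) = k (x \<otimes>\<^bsub>A\<^esub> inv\<^bsub>A\<^esub> y)"
      using diff by simp
    also have "\<dots> = k x \<otimes> inv (k y)"
      using diff k.hom_mult [of x "inv\<^bsub>A\<^esub> y"] k.hom_inv [of y] by simp
    finally show ?case
      using diff B by (simp add: generate.eng generate_m_inv_closed)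
  qed (auto intro: generate.incl)
  then show ?thesis
    using k_p [OF assms] p.hom_closed [OF assms] by (metis carrier_free_Abelian_group_iff)
qed

end

section \<open>Cycles, boundaries and homology classes of a chain complex\<close>

locale chain_complex_homology =
  fixes C :: "int \<Rightarrow> 'a set" and d :: "int \<Rightarrow> ('a \<Rightarrow>\<^sub>0 int) \<Rightarrow> ('a \<Rightarrow>\<^sub>0 int)"
  assumes complex: "chain_complex C d"
begin

lemma d_group_hom: "group_hom (free_Abelian_group (C q)) (free_Abelian_group (C (q - 1))) (d q)"
  using complex by (simp add: chain_complex_def group_hom_def group_hom_axioms_def)

lemma cycles_eq: "cycles C d q = {x. Poly_Mapping.keys x \<subseteq> C q \<and> d q x = 0}"
  by (simp add: cycles_def kernel_def)

lemma cycles_subgroup: "subgroup (cycles C d q) (free_Abelian_group (C q))"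
  unfolding cycles_def by (rule group_hom.subgroup_kernel [OF d_group_hom])

lemma carrier_cycle_group: "carrier (cycle_group C d q) = cycles C d q"
  unfolding cycle_group_def
  by (rule subgroup.carrier_subgroup_generated_subgroup [OF cycles_subgroup])

lemma cycle_group_simps:
  "x \<otimes>\<^bsub>cycle_group C d q\<^esub> y = x + y" "\<one>\<^bsub>cycle_group C d q\<^esub> = 0"
  by (simp_all add: cycle_group_def)

lemma comm_group_cycle_group: "comm_group (cycle_group C d q)"
  unfolding cycle_group_def
  by (intro group.abelian_subgroup_generated group_free_Abelian_group abelian_free_Abelian_group)

lemma boundaries_subset_cycles: "boundaries C d q \<subseteq> cycles C d q"
proof
  fix x
  assume "x \<in> boundaries C d q"
  then obtain y where y: "y \<in> carrier (free_Abelian_group (C (q + 1)))" "x = d (q + 1) y"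
    by (auto simp: boundaries_def)
  have "x \<in> carrier (free_Abelian_group (C q))"
    using group_hom.hom_closed [OF d_group_hom y(1)] y(2) by simp
  moreover have "d q x = 0"
    using complex y by (simp add: chain_complex_def)
  ultimately show "x \<in> cycles C d q"
    by (simp add: cycles_eq)
qed

lemma boundaries_normal: "boundaries C d q \<lhd> cycle_group C d q"
proof -
  have "subgroup (boundaries C d q) (free_Abelian_group (C q))"
    using group_hom.img_is_subgroup [OF d_group_hom [of "q + 1"]] by (simp add: boundaries_def)
  then have "subgroup (boundaries C d q) (cycle_group C d q)"
    using boundaries_subset_cycles [of q] carrier_cycle_group [of q]
    by (simp add: cycle_group_def group.subgroup_subgroup_generated_iff)
  then show ?thesis
    by (simp add: comm_group.normal_iff_subgroup [OF comm_group_cycle_group])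
qed

lemma comm_group_homology: "comm_group (homology C d q)"
  unfolding homology_def
  using boundaries_normal
  by (intro comm_group.abelian_FactGroup comm_group_cycle_group) (simp add: normal_imp_subgroup)

lemma homology_class_group_hom:
  "group_hom (cycle_group C d q) (homology C d q) (homology_class C d q)"
proof -
  have "(\<lambda>z. homology_class C d q z) \<in> hom (cycle_group C d q) (homology C d q)"
    unfolding homology_class_def homology_def by (rule normal.r_coset_hom_Mod [OF boundaries_normal])
  then show ?thesis
    using comm_group_cycle_group [of q] comm_group_homology [of q]
    by (simp add: group_hom_def group_hom_axioms_def comm_group_def)
qed

lemma carrier_homology: "carrier (homology C d q) = homology_class C d q ` cycles C d q"
  by (simp add: homology_def homology_class_def [abs_def] carrier_FactGroup carrier_cycle_group)

lemma homology_class_boundary: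
  assumes "z \<in> boundaries C d q"
  shows "homology_class C d q z = \<one>\<^bsub>homology C d q\<^esub>"
proof -
  have "subgroup (boundaries C d q) (cycle_group C d q)"
    using boundaries_normal by (simp add: normal_imp_subgroup)
  then show ?thesis
    using assms comm_group_cycle_group [of q]
    by (simp add: homology_class_def homology_def comm_group_def group.coset_join2 subgroup.mem_carrier)
qed

lemma homology_class_cong:
  assumes z: "z \<in> cycles C d q" and diff: "z - w \<in> boundaries C d q"
  shows "homology_class C d q z = homology_class C d q w"
proof -
  interpret cls: group_hom "cycle_group C d q" "homology C d q" "homology_class C d q"
    by (rule homology_class_group_hom)
  have b: "z - w \<in> cycles C d q"
    using diff boundaries_subset_cycles by blast
  \<comment> \<open>\<open>w\<close> is recovered as \<open>z - (z - w)\<close>, a difference of two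
    cycles.\<close>
  have w: "w \<in> cycles C d q"
  proof -
    have "z - (z - w) \<in> cycles C d q"
      using subgroup.m_closed [OF cycles_subgroup z subgroup.m_inv_closed [OF cycles_subgroup b]] b
      by (simp add: cycles_eq)
    then show ?thesis by simp
  qed
  have "homology_class C d q ((z - w) \<otimes>\<^bsub>cycle_group C d q\<^esub> w)
      = homology_class C d q (z - w) \<otimes>\<^bsub>homology C d q\<^esub> homology_class C d q w"
    using b w by (simp add: carrier_cycle_group)
  then show ?thesis
    using w cls.hom_closed [of w]
    by (simp add: homology_class_boundary [OF diff] cycle_group_simps carrier_cycle_group)
qed

end

section \<open>Passage from an AT-model to homology\<close>

locale AT_model_homology = chain_complex_homology C d
  for C :: "int \<Rightarrow> 'a set" and d +
  fixes H :: "int \<Rightarrow> 'b set" and f g \<phi> and l :: int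
  assumes contraction: "chain_contraction C d H (\<lambda>q x. 0) f g \<phi> l"
begin

lemma l_nonzero: "l \<noteq> 0"
  and f_hom: "f q \<in> hom (free_Abelian_group (C q)) (free_Abelian_group (H q))"
  and g_hom: "g q \<in> hom (free_Abelian_group (H q)) (free_Abelian_group (C q))"
  and phi_hom: "\<phi> q \<in> hom (free_Abelian_group (C q)) (free_Abelian_group (C (q + 1)))"
  using contraction unfolding chain_contraction_def chain_map_def by blast+

text \<open>The contraction identities with carriers unfolded to supports. The zero differential on
  \<open>H\<close> reduces the chain map equations to the last two facts.\<close>

lemma f_g: "Poly_Mapping.keys y \<subseteq> H q \<Longrightarrow> f q (g q y) = frag_cmul l y"
  and homotopy: "Poly_Mapping.keys x \<subseteq> C q \<Longrightarrow>
    frag_cmul l x - g q (f q x) = \<phi> (q - 1) (d q x) + d (q + 1) (\<phi> q x)"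
  and f_d: "Poly_Mapping.keys x \<subseteq> C q \<Longrightarrow> f (q - 1) (d q x) = 0"
  and d_g: "Poly_Mapping.keys y \<subseteq> H q \<Longrightarrow> d q (g q y) = g (q - 1) 0"
  using contraction unfolding chain_contraction_def chain_map_def by simp_all

lemma g_cycle:
  assumes "Poly_Mapping.keys y \<subseteq> H q"
  shows "g q y \<in> cycles C d q"
proof -
  have "g q y \<in> carrier (free_Abelian_group (C q))"
    using hom_in_carrier [OF g_hom] assms by simp
  moreover have "g (q - 1) 0 = 0"
    using hom_one [OF g_hom [of "q - 1"]] by simp
  ultimately show ?thesis
    using d_g [OF assms] by (simp add: cycles_eq)
qed

lemma f_boundary: "z \<in> boundaries C d q \<Longrightarrow> f q z = 0"
  using f_d [of _ "q + 1"] by (auto simp: boundaries_def)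

text \<open>\<open>f\<close> kills boundaries but sends this chain to \<open>l\<close> times a
  generator, which is nonzero.\<close>

lemma g_frag_of_not_boundary: "h \<in> H q \<Longrightarrow> g q (frag_of h) \<notin> boundaries C d q"
  using f_boundary [of "g q (frag_of h)" q] f_g [of "frag_of h" q] l_nonzero by auto

text \<open>All of \<open>l \<int>[H]\<close> lies in the image of \<open>f\<close>, which involves only the finitely many generators
  occurring in the images of the basis of \<open>C\<close>.\<close>

lemma finite_H:
  assumes "finite (C q)"
  shows "finite (H q)"
proof (rule finite_subset)
  let ?K = "\<Union>c\<in>C q. Poly_Mapping.keys (f q (frag_of c))"
  have keys_f: "Poly_Mapping.keys (f q x) \<subseteq> ?K" if "Poly_Mapping.keys x \<subseteq> C q" for x
    using that
  proof (induction rule: free_Abelian_group_induct [consumes 1, case_names zero diff frag_of])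
    case zero
    then show ?case
      using hom_one [OF f_hom [of q]] by simp
  next
    case (diff x y)
    then show ?case
      using keys_diff [of "f q x" "f q y"] hom_frag_diff [OF f_hom [of q], of x y] by auto
  qed auto
  show "H q \<subseteq> ?K"
  proof
    fix h
    assume h: "h \<in> H q"
    have "Poly_Mapping.keys (g q (frag_of h)) \<subseteq> C q"
      using g_cycle [of "frag_of h" q] h by (simp add: cycles_eq)
    then have "Poly_Mapping.keys (frag_cmul l (frag_of h)) \<subseteq> ?K"
      using keys_f [of "g q (frag_of h)"] f_g [of "frag_of h" q] h by simp
    moreover have "h \<in> Poly_Mapping.keys (frag_cmul l (frag_of h))"
      using l_nonzero by simp
    ultimately show "h \<in> ?K" by blast
  qed
  show "finite ?K"
    using assms by simp
qed

text \<open>On chains, \<open>f q\<close> itself is the detecting homomorphism.\<close>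

lemma Z_independent_chains: "Z_independent (free_Abelian_group (C q)) (H q) (\<lambda>h. g q (frag_of h))"
proof (rule Z_independentI [OF abelian_free_Abelian_group f_hom l_nonzero])
  show "g q (frag_of h) \<in> carrier (free_Abelian_group (C q))" if "h \<in> H q" for h
    using g_cycle [of "frag_of h" q] that by (simp add: cycles_eq)
qed (simp add: f_g)

text \<open>\<open>f q\<close> vanishes on boundaries and hence factors through homology as
  \<open>p\<close>. That the class map after \<open>g q\<close> inverts \<open>p\<close> up to
  \<open>l\<close> is the contraction identity read modulo boundaries.\<close>

lemma homology_quasi_inverse:
  "\<exists>p. free_quasi_inverse (homology C d q) (H q) p (\<lambda>y. homology_class C d q (g q y)) l"
proof -
  interpret cls: group_hom "cycle_group C d q" "homology C d q" "homology_class C d q"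
    by (rule homology_class_group_hom)
  have "f q \<in> hom (cycle_group C d q) (free_Abelian_group (H q))"
    unfolding cycle_group_def
    by (rule group.hom_from_subgroup_generated [OF group_free_Abelian_group f_hom])
  then interpret f: group_hom "cycle_group C d q" "free_Abelian_group (H q)" "f q"
    using cls.G.is_group by (simp add: group_hom_def group_hom_axioms_def)
  have "boundaries C d q \<subseteq> kernel (cycle_group C d q) (free_Abelian_group (H q)) (f q)"
    using boundaries_subset_cycles f_boundary by (auto simp: kernel_def carrier_cycle_group)
  then obtain p where p: "p \<in> hom (homology C d q) (free_Abelian_group (H q))"
    "\<And>z. z \<in> cycles C d q \<Longrightarrow> p (homology_class C d q z) = f q z"
    using f.FactGroup_universal_kernel [OF boundaries_normal]
    unfolding homology_def homology_class_def carrier_cycle_group by metis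
  have g: "g q \<in> hom (free_Abelian_group (H q)) (cycle_group C d q)"
    unfolding cycle_group_def using g_hom g_cycle
    by (auto simp: hom_into_subgroup_eq [OF cycles_subgroup group_free_Abelian_group])
  have "free_quasi_inverse (homology C d q) (H q) p (homology_class C d q \<circ> g q) l"
  proof (intro free_quasi_inverse.intro comm_group_homology free_quasi_inverse_axioms.intro
      p(1) l_nonzero Group.hom_compose [OF g cls.homh])
    fix y
    assume "y \<in> carrier (free_Abelian_group (H q))"
    then show "p ((homology_class C d q \<circ> g q) y) = frag_cmul l y"
      using p(2) [OF g_cycle] f_g by simp
  next
    fix x
    assume "x \<in> carrier (homology C d q)"
    then obtain z where z: "z \<in> cycles C d q" "x = homology_class C d q z"
      by (auto simp: carrier_homology)
    have keys_z: "Poly_Mapping.keys z \<subseteq> C q" and d_z: "d q z = 0"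
      using z by (auto simp: cycles_eq)
    \<comment> \<open>Powers in the cycle group become scalar multiples of chains, the form in which
      the homotopy identity is stated.\<close>
    have pow: "z [^]\<^bsub>cycle_group C d q\<^esub> l = frag_cmul l z"
      using keys_z z(1) group.int_pow_subgroup_generated [OF group_free_Abelian_group] carrier_cycle_group [of q]
      unfolding cycle_group_def by (metis int_pow_free_Abelian_group)
    have lz: "frag_cmul l z \<in> cycles C d q"
      using cls.G.int_pow_closed [of z l] z(1) by (simp add: pow carrier_cycle_group)
    \<comment> \<open>On a cycle the term with \<open>d q z\<close> disappears, and only the
      boundary of \<open>\<phi> q z\<close> remains.\<close>
    have "\<phi> (q - 1) 0 = 0"
      using hom_one [OF phi_hom [of "q - 1"]] by simp
    then have "frag_cmul l z - g q (f q z) = d (q + 1) (\<phi> q z)"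
      using homotopy [OF keys_z] d_z by simp
    moreover have "\<phi> q z \<in> carrier (free_Abelian_group (C (q + 1)))"
      using hom_in_carrier [OF phi_hom] keys_z by simp
    ultimately have "frag_cmul l z - g q (f q z) \<in> boundaries C d q"
      unfolding boundaries_def by blast
    then have "homology_class C d q (g q (f q z)) = homology_class C d q (frag_cmul l z)"
      using homology_class_cong [OF lz] by simp
    also have "\<dots> = x [^]\<^bsub>homology C d q\<^esub> l"
      using cls.hom_int_pow [of z l] z by (simp add: pow carrier_cycle_group)
    finally show "(homology_class C d q \<circ> g q) (p x) = x [^]\<^bsub>homology C d q\<^esub> l"
      using p(2) z by simp
  qed
  then show ?thesis
    by (auto simp: comp_def)
qed

end

theorem corollary4p4:
  fixes C :: "int \<Rightarrow> 'a set"
    and d :: "int \<Rightarrow> ('a \<Rightarrow>\<^sub>0 int) \<Rightarrow> ('a \<Rightarrow>\<^sub>0 int)"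
    and H :: "int \<Rightarrow> 'b set"
    and f :: "int \<Rightarrow> ('a \<Rightarrow>\<^sub>0 int) \<Rightarrow> ('b \<Rightarrow>\<^sub>0 int)"
    and g :: "int \<Rightarrow> ('b \<Rightarrow>\<^sub>0 int) \<Rightarrow> ('a \<Rightarrow>\<^sub>0 int)"
    and \<phi> :: "int \<Rightarrow> ('a \<Rightarrow>\<^sub>0 int) \<Rightarrow> ('a \<Rightarrow>\<^sub>0 int)"
    and l :: int
  assumes "finite_chain_complex C d"
    and "AT_model C d H f g \<phi> l"
    and "l \<noteq> 0"
  shows "(\<exists>F. free_homology C d F) \<and>
    (\<forall>F. free_homology C d F \<longrightarrow>
       (\<forall>q. free_Abelian_group (H q) \<cong> subgroup_generated (homology C d q) (F q))) \<and>
    (\<forall>q. \<forall>h \<in> H q. g q (frag_of h) \<in> cycles C d q \<and> g q (frag_of h) \<notin> boundaries C d q) \<and>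
    (\<forall>q. Z_independent (free_Abelian_group (C q)) (H q) (\<lambda>h. g q (frag_of h))) \<and>
    (\<forall>q. Z_independent (homology C d q) (H q) (\<lambda>h. homology_class C d q (g q (frag_of h)))) \<and>
    (\<forall>F. free_homology C d F \<longrightarrow>
       (\<forall>q. \<forall>\<alpha> \<in> F q. \<alpha> [^]\<^bsub>homology C d q\<^esub> l
          \<in> generate (homology C d q) ((\<lambda>h. homology_class C d q (g q (frag_of h))) ` H q)))"
proof -
  interpret AT_model_homology C d H f g \<phi> l
    using assms(2)
    by unfold_locales (simp_all add: AT_model_def finite_chain_complex_def)
  have fin: "finite (H q)" for q
    using assms(1) by (intro finite_H) (simp add: finite_chain_complex_def)
  obtain p where p: "free_quasi_inverse (homology C d q) (H q) (p q) (\<lambda>y. homology_class C d q (g q y)) l" for q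
    using homology_quasi_inverse by metis
  \<comment> \<open>A complement is chosen separately in each degree.\<close>
  have ex: "\<exists>F. free_homology C d F"
    unfolding free_homology_def using free_quasi_inverse.free_complement_exists [OF p fin] by metis
  have iso: "free_Abelian_group (H q) \<cong> subgroup_generated (homology C d q) (F q)"
    if "free_homology C d F" for F q
    using that free_quasi_inverse.free_complement_iso [OF p fin] by (simp add: free_homology_def)
  have cycle: "g q (frag_of h) \<in> cycles C d q" if "h \<in> H q" for q h
    using that by (simp add: g_cycle)
  \<comment> \<open>Here the detecting homomorphism is the induced map \<open>p q\<close>, which
    sends the class of \<open>g q (frag_of h)\<close> to \<open>l\<close> times the generator
    \<open>h\<close>.\<close>
  have indep: "Z_independent (homology C d q) (H q) (\<lambda>h. homology_class C d q (g q (frag_of h)))" for q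
  proof (rule Z_independentI [OF comm_group_homology free_quasi_inverse.p_hom [OF p] l_nonzero])
    show "homology_class C d q (g q (frag_of h)) \<in> carrier (homology C d q)" if "h \<in> H q" for h
      using cycle that by (auto simp: carrier_homology)
  qed (simp add: free_quasi_inverse.p_k [OF p])
  have gen: "\<alpha> [^]\<^bsub>homology C d q\<^esub> l
      \<in> generate (homology C d q) ((\<lambda>h. homology_class C d q (g q (frag_of h))) ` H q)"
    if "free_homology C d F" "\<alpha> \<in> F q" for F q \<alpha>
  proof (rule free_quasi_inverse.pow_in_generate [OF p])
    show "\<alpha> \<in> carrier (homology C d q)"
      using that subgroup.mem_carrier unfolding free_homology_def free_complement_def by metis
  qed
  show ?thesis
    using ex iso cycle g_frag_of_not_boundary Z_independent_chains indep gen by blast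
qed

end
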